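(* There is a universal constant $C$ such that for every integer $n\geq2$, with $K$ a random variable on $\{1,\dots,n\}$ with $\mathbb{P}[K=k]=\pi(k)=N(n,k)/C_n$ and $W=(K-\mu_n)/\sigma_n$, $$\sup_{x\in\mathbb{R}}\bigl|\mathbb{P}[W\leq x]-\Phi(x)\bigr|\leq\frac{C}{n^{1/2}},$$ where $\Phi$ is the standard normal distribution function.
   Context: Narayana numbers: $N(n,k)=\frac1n\binom{n}{k-1}\binom{n}{k}$ for $1\le k\le n$. Catalan numbers: $C_n=\frac{1}{n+1}\binom{2n}{n}=\sum_{k=1}^n N(n,k)$. Thus $\pi(k)=N(n,k)/C_n$ is a probability distribution on $\{1,\dots,n\}$. Furthermore $\mu_n=\frac{n+1}{2}$, $\sigma_n^2=\frac{(n-1)(n+1)}{4(2n-1)}$ and $\sigma_n>0$. *)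

theory Defs
  imports "HOL-Probability.Probability"
begin

definition narayana :: "nat \<Rightarrow> nat \<Rightarrow> real" where
  "narayana n k = 1 / real n * real (n choose (k - 1)) * real (n choose k)"

definition catalan :: "nat \<Rightarrow> real" where
  "catalan n = 1 / real (n + 1) * real ((2 * n) choose n)"

lemma sum_narayana:
  assumes "n \<ge> 1"
  shows "(\<Sum>k=1..n. narayana n k) = catalan n"
proof -
  obtain m where m: "n = Suc m" using assms by (cases n) auto
  have "(\<Sum>k=1..n. (n choose (k - 1)) * (n choose k))
      = (\<Sum>k\<le>m. (n choose k) * (n choose (m - k)))"
  proof -
    have "(\<Sum>k=1..n. (n choose (k - 1)) * (n choose k))
        = (\<Sum>k=0..m. (n choose k) * (n choose Suc k))"
      unfolding m by (simp only: One_nat_def sum.shift_bounds_cl_Suc_ivl diff_Suc_Suc diff_zero diff_Suc_1)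
    also have "\<dots> = (\<Sum>k\<le>m. (n choose k) * (n choose (m - k)))"
      unfolding atLeast0AtMost
    proof (rule sum.cong)
      fix k assume "k \<in> {..m}"
      then have "n choose Suc k = n choose (n - Suc k)"
        by (intro binomial_symmetric) (auto simp: m)
      then show "(n choose k) * (n choose Suc k) = (n choose k) * (n choose (m - k))"
        by (simp add: m)
    qed simp
    finally show ?thesis .
  qed
  also have "\<dots> = (2 * n) choose m"
    using vandermonde[of n n m] by (simp add: mult_2)
  finally have s: "(\<Sum>k=1..n. (n choose (k - 1)) * (n choose k)) = (2 * n) choose m" .
  have "Suc m * (2 * n choose Suc m) = (2 * n - m) * (2 * n choose m)"
    using binomial_absorb_comp[of "2 * n" m] binomial_absorption[of m "2 * n"] by simp
  then have "n * (2 * n choose n) = (n + 1) * (2 * n choose m)" by (simp add: m)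
  then have "real n * real (2 * n choose n) = real (n + 1) * real (2 * n choose m)"
    by (metis of_nat_mult)
  moreover have "(\<Sum>k=1..n. narayana n k) = real (2 * n choose m) / real n"
    unfolding narayana_def s[symmetric] by (simp add: sum_divide_distrib)
  moreover have "real (2 * n choose m) / real n = catalan n"
  proof -
    have "real (2 * n choose m) * real (n + 1) = real (2 * n choose n) * real n"
      using calculation(1) by (simp only: mult.commute)
    then show ?thesis
      using assms unfolding catalan_def
      by (simp add: frac_eq_eq del: of_nat_add of_nat_Suc)
  qed
  ultimately show ?thesis by simp
qed

text \<open>The restriction to \<open>1 \<le> k \<le> n\<close> matters at \<open>k = 0\<close>: there truncated subtraction
  makes \<open>narayana n 0 = 1 / n\<close>. For \<open>n = 0\<close> the function below is not a mass function and
  \<open>narayana_pmf 0\<close> is unspecified.\<close>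

definition narayana_pmf :: "nat \<Rightarrow> nat pmf" where
  "narayana_pmf n =
     embed_pmf (\<lambda>k. if k \<in> {1..n} then narayana n k / catalan n else 0)"

lemma pmf_narayana_pmf:
  assumes "n \<ge> 1"
  shows "pmf (narayana_pmf n) k = (if k \<in> {1..n} then narayana n k / catalan n else 0)"
  unfolding narayana_pmf_def
proof (rule pmf_embed_pmf)
  let ?f = "\<lambda>k. if k \<in> {1..n} then narayana n k / catalan n else 0"
  have pos: "catalan n > 0" by (simp add: catalan_def)
  show nn: "0 \<le> ?f k" for k
    using pos by (simp add: narayana_def)
  have "(\<integral>\<^sup>+ k. ennreal (?f k) \<partial>count_space UNIV) = (\<Sum>k\<in>{1..n}. ennreal (?f k))"
    by (rule nn_integral_count_space') auto
  also have "\<dots> = ennreal (\<Sum>k\<in>{1..n}. ?f k)"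
    using nn by (rule sum_ennreal)
  also have "(\<Sum>k\<in>{1..n}. ?f k) = (\<Sum>k=1..n. narayana n k / catalan n)"
    by (rule sum.cong) auto
  also have "\<dots> = 1"
    using pos by (simp only: sum_divide_distrib[symmetric] sum_narayana[OF assms]) simp
  finally show "(\<integral>\<^sup>+ k. ennreal (?f k) \<partial>count_space UNIV) = 1" by simp
qed

definition narayana_mean :: "nat \<Rightarrow> real" where
  "narayana_mean n = (real n + 1) / 2"

definition narayana_sd :: "nat \<Rightarrow> real" where
  "narayana_sd n = sqrt ((real n - 1) * (real n + 1) / (4 * (2 * real n - 1)))"

definition narayana_std :: "nat \<Rightarrow> nat \<Rightarrow> real" where
  "narayana_std n k = (real k - narayana_mean n) / narayana_sd n"

lemma narayana_sd_pos: "n \<ge> 2 \<Longrightarrow> narayana_sd n > 0"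
  by (simp add: narayana_sd_def)

abbreviation std_normal_cdf :: "real \<Rightarrow> real" where
  "std_normal_cdf \<equiv> cdf std_normal_distribution"

text \<open>Suprema over \<open>real\<close> are only meaningful for sets that are bounded above; the
  distance between two distribution functions satisfies this.\<close>

lemma bdd_above_kolmogorov:
  "bdd_above (range (\<lambda>x. \<bar>\<P>(K in measure_pmf p. f K \<le> x) - std_normal_cdf x\<bar>))"
proof (rule bdd_aboveI2)
  fix x
  interpret real_distribution std_normal_distribution by (rule real_dist_normal_dist)
  have "\<bar>\<P>(K in measure_pmf p. f K \<le> x)\<bar> \<le> 1"
    by (simp add: measure_pmf.prob_le_1)
  moreover have "0 \<le> std_normal_cdf x" "std_normal_cdf x \<le> 1"
    by (simp_all add: cdf_nonneg cdf_bounded_prob)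
  ultimately show "\<bar>\<P>(K in measure_pmf p. f K \<le> x) - std_normal_cdf x\<bar> \<le> 2" by linarith
qed

end

theory Submission
  imports Defs "HOL-Real_Asymp.Real_Asymp"
begin

text \<open>Stein's method. The ratio recursion of the Narayana numbers says that
  \<open>\<tau> k = (n - k) (n - k + 1) / (2 n)\<close> is a discrete Stein kernel of \<open>K\<close>:
  \<open>E ((K - \<mu>) g K) = E (\<tau> K (g (K + 1) - g K))\<close> for every \<open>g\<close>. Put \<open>d = 1 / \<sigma>\<close> and let \<open>f\<close>
  solve Stein's equation \<open>f' w - w f w = 1 (w \<le> x) - \<Phi> x\<close>. Then \<open>P (W \<le> x) - \<Phi> x\<close> equals
  \<open>E (f' W (1 - \<tau> K / \<sigma>\<^sup>2)) - E (\<tau> K / \<sigma> (f (W + d) - f W - d f' W))\<close>. The first term is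
  \<open>O(1 / \<sigma>)\<close> because \<open>\<tau> K\<close> concentrates around \<open>\<sigma>\<^sup>2\<close>. In the second, the Taylor remainder is
  \<open>O(d\<^sup>2 (1 + \<bar>W\<bar>))\<close> except where \<open>f'\<close> jumps between \<open>W\<close> and \<open>W + d\<close>, and the contribution of
  that atom is controlled by the kernel identity for a step function \<open>g\<close>.\<close>

section \<open>The normal distribution function and its Mills ratio\<close>

lemma std_normal_cdf_bounds: "0 \<le> std_normal_cdf x" "std_normal_cdf x \<le> 1"
proof -
  interpret real_distribution std_normal_distribution by (rule real_dist_normal_dist)
  show "0 \<le> std_normal_cdf x" "std_normal_cdf x \<le> 1"
    by (simp_all add: cdf_nonneg cdf_bounded_prob)
qed

lemma has_real_derivative_std_normal_density:
  "(std_normal_density has_real_derivative - x * std_normal_density x) (at x)"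
proof -
  have "((\<lambda>x. exp (- x\<^sup>2 / 2)) has_real_derivative - x * exp (- x\<^sup>2 / 2)) (at x)"
    by (auto intro!: derivative_eq_intros)
  from DERIV_cmult[OF this, of "1 / sqrt (2 * pi)"]
  show ?thesis
    by (simp add: std_normal_density_def[abs_def] mult.left_commute)
qed

text \<open>The fundamental theorem of calculus, once increments of the distribution function are
  written as Henstock-Kurzweil integrals of the continuous density over closed intervals.\<close>

lemma has_real_derivative_std_normal_cdf:
  "(std_normal_cdf has_real_derivative std_normal_density x) (at x)"
proof -
  interpret real_distribution std_normal_distribution by (rule real_dist_normal_dist)
  \<comment> \<open>A base point strictly to the left of \<open>x\<close> puts \<open>x\<close> in
    the interior of \<open>{a..x+1}\<close>, so the one-sided derivative below becomes a full
    one.\<close>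
  define a where "a = x - 1"
  have cont: "continuous_on S std_normal_density" for S
    by (intro DERIV_continuous_on[OF DERIV_subset[OF has_real_derivative_std_normal_density]]) simp
  have eq: "std_normal_cdf a + integral {a..y} std_normal_density = std_normal_cdf y" if "a \<le> y" for y
  proof (cases "a = y")
    case False
    then have "a < y" using that by simp
    have int: "set_integrable lborel {a..y} std_normal_density"
      by (intro borel_integrable_atLeastAtMost' cont)
    have "std_normal_cdf y - std_normal_cdf a = measure std_normal_distribution {a<..y}"
      by (rule cdf_diff_eq[OF \<open>a < y\<close>])
    also have "\<dots> = enn2real (\<integral>\<^sup>+ z. ennreal (indicator {a<..y} z * std_normal_density z) \<partial>lborel)"
      unfolding measure_def
      by (subst emeasure_density)
         (auto intro!: arg_cong[where f=enn2real] nn_integral_cong simp: indicator_def)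
    also have "\<dots> = (LINT z:{a<..y}|lborel. std_normal_density z)"
      unfolding set_lebesgue_integral_def real_scaleR_def
      by (rule integral_eq_nn_integral[symmetric]) auto
    \<comment> \<open>The distribution function yields the half-open interval; adding the null set
      \<open>{a}\<close> closes it.\<close>
    also have "\<dots> = (LINT x:{a..y}|lborel. std_normal_density x)"
      unfolding set_lebesgue_integral_def
      by (intro integral_cong_AE) (use AE_lborel_singleton[of a] in \<open>auto simp: indicator_def elim!: eventually_mono\<close>)
    also have "\<dots> = integral {a..y} std_normal_density"
      by (rule set_borel_integral_eq_integral(2)[OF int])
    finally show ?thesis by simp
  qed simp
  have "((\<lambda>y. integral {a..y} std_normal_density) has_real_derivative std_normal_density x)
      (at x within {a..x+1})"
    by (rule integral_has_real_derivative) (auto intro: cont simp: a_def)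
  then have "((\<lambda>y. integral {a..y} std_normal_density) has_real_derivative std_normal_density x) (at x)"
    by (subst (asm) at_within_interior) (auto simp: a_def)
  then have "((\<lambda>y. std_normal_cdf a + integral {a..y} std_normal_density)
      has_real_derivative std_normal_density x) (at x)"
    by (auto intro!: derivative_eq_intros)
  then show ?thesis
    by (rule has_field_derivative_transform_within_open[where S="{a<..}"]) (use eq in \<open>auto simp: a_def\<close>)
qed

text \<open>The density is even, so \<Phi>(x) + \<Phi>(-x) has derivative zero; the limit at
  infinity identifies the constant as 1.\<close>

lemma std_normal_cdf_uminus: "std_normal_cdf (- x) = 1 - std_normal_cdf x"
proof -
  interpret real_distribution std_normal_distribution by (rule real_dist_normal_dist)
  let ?g = "\<lambda>x. std_normal_cdf x + std_normal_cdf (- x)"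
  have "(?g has_real_derivative 0) (at y)" for y
    by (rule derivative_eq_intros has_real_derivative_std_normal_cdf
          DERIV_chain'[OF DERIV_minus[OF DERIV_ident] has_real_derivative_std_normal_cdf]
        | simp add: std_normal_density_def)+
  then have "?g y = ?g 0" for y
    by (intro DERIV_isconst_all[where f="?g"] allI)
  then obtain c where const: "?g y = c" for y
    by blast
  have "(?g \<longlongrightarrow> 1 + 0) at_top"
    by (intro tendsto_add cdf_lim_at_top_prob filterlim_compose[OF cdf_lim_at_bot filterlim_uminus_at_bot_at_top])
  then have "c = 1"
    by (simp add: const tendsto_const_iff)
  then show ?thesis
    using const[of x] by simp
qed

text \<open>The function \<open>?U\<close>, the density over x minus the tail, is decreasing on the
  positive axis and tends to 0, hence is nonnegative there.\<close>

lemma std_normal_tail_le: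
  assumes "0 < x"
  shows "x * (1 - std_normal_cdf x) \<le> std_normal_density x"
proof -
  interpret real_distribution std_normal_distribution by (rule real_dist_normal_dist)
  let ?U = "\<lambda>x. std_normal_density x / x - (1 - std_normal_cdf x)"
  have dU: "(?U has_real_derivative - std_normal_density y / y\<^sup>2) (at y)" if "0 < y" for y
    by (rule derivative_eq_intros has_real_derivative_std_normal_cdf
          has_real_derivative_std_normal_density refl
        | use that in \<open>simp add: field_simps power2_eq_square\<close>)+
  have "?U y \<le> ?U x" if "x \<le> y" for y
  proof (rule DERIV_nonpos_imp_nonincreasing[OF that])
    fix z assume "x \<le> z" "z \<le> y"
    then show "\<exists>D. DERIV ?U z :> D \<and> D \<le> 0"
      using dU[of z] assms by (intro exI[of _ "- std_normal_density z / z\<^sup>2"]) auto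
  qed
  then have "\<forall>\<^sub>F y in at_top. ?U y \<le> ?U x"
    by (rule eventually_at_top_linorderI)
  moreover have "(?U \<longlongrightarrow> 0 - (1 - 1)) at_top"
  proof (intro tendsto_diff tendsto_const cdf_lim_at_top_prob)
    show "((\<lambda>x. std_normal_density x / x) \<longlongrightarrow> 0) at_top"
      unfolding std_normal_density_def by real_asymp
  qed
  ultimately have "0 \<le> ?U x"
    by (intro tendsto_upperbound[of ?U _ at_top]) auto
  then show ?thesis
    using assms by (simp add: field_simps)
qed

definition mills_ratio :: "real \<Rightarrow> real" where
  "mills_ratio x = (1 - std_normal_cdf x) / std_normal_density x"

lemma std_normal_density_pos: "0 < std_normal_density x"
  by (simp add: normal_density_pos)

text \<open>Thus \<open>mills_ratio\<close> solves Stein's equation with right-hand side -1, and its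
  reflection \<open>mills_ratio (- w)\<close> solves it with right-hand side 1. Multiples of these
  two form the branches of \<open>stein_solution\<close>.\<close>

lemma has_real_derivative_mills_ratio:
  "(mills_ratio has_real_derivative x * mills_ratio x - 1) (at x)"
proof -
  have "((\<lambda>x. (1 - std_normal_cdf x) / std_normal_density x) has_real_derivative
      x * ((1 - std_normal_cdf x) / std_normal_density x) - 1) (at x)"
    by (rule derivative_eq_intros has_real_derivative_std_normal_cdf
          has_real_derivative_std_normal_density refl
        | use std_normal_density_pos[of x] in \<open>simp add: field_simps\<close>)+
  then show ?thesis
    by (simp add: mills_ratio_def[abs_def])
qed

lemma mills_ratio_nonneg: "0 \<le> mills_ratio x"
  unfolding mills_ratio_def using std_normal_density_pos[of x] std_normal_cdf_bounds(2)[of x] by simp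

text \<open>The tail estimate divided by the density. It makes the derivative
  \<open>x * mills_ratio x - 1\<close> nonpositive and later bounds
  \<open>w * stein_solution x w\<close>.\<close>

lemma mult_mills_ratio_le_1: "x * mills_ratio x \<le> 1"
proof (cases "0 < x")
  case True
  then show ?thesis
    using std_normal_tail_le[of x] std_normal_density_pos[of x]
    by (simp add: mills_ratio_def divide_le_eq_1)
next
  case False
  then have "x * mills_ratio x \<le> 0"
    by (intro mult_nonpos_nonneg mills_ratio_nonneg) simp
  then show ?thesis by simp
qed

lemma mills_ratio_antimono: "x \<le> y \<Longrightarrow> mills_ratio y \<le> mills_ratio x"
  by (rule DERIV_nonpos_imp_nonincreasing)
     (use has_real_derivative_mills_ratio mult_mills_ratio_le_1 in \<open>fastforce+\<close>)


section \<open>The solution of Stein's equation\<close>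

text \<open>As \<open>mills_ratio (- w)\<close> is \<open>\<Phi> w / \<phi> w\<close>, this is the bounded solution of
  \<open>f' w - w f w = 1 (w \<le> x) - \<Phi> x\<close>; its derivative jumps at \<open>w = x\<close>.\<close>

definition stein_solution :: "real \<Rightarrow> real \<Rightarrow> real" where
  "stein_solution x w =
     (if w \<le> x then (1 - std_normal_cdf x) * mills_ratio (- w) else std_normal_cdf x * mills_ratio w)"

lemma std_normal_cdf_mono: "x \<le> y \<Longrightarrow> std_normal_cdf x \<le> std_normal_cdf y"
  by (rule DERIV_nonneg_imp_nondecreasing)
     (use has_real_derivative_std_normal_cdf std_normal_density_pos in \<open>fastforce intro: less_imp_le\<close>)+

lemma mills_ratio_uminus: "mills_ratio (- w) = std_normal_cdf w / std_normal_density w"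
  unfolding mills_ratio_def std_normal_cdf_uminus by (simp add: std_normal_density_def)

lemma stein_solution_nonneg: "0 \<le> stein_solution x w"
  by (simp add: stein_solution_def std_normal_cdf_bounds mills_ratio_nonneg)

text \<open>Where the branch is already a multiple of \<open>mills_ratio \<bar>w\<bar>\<close>, its
  factor is at most 1. Otherwise w lies between 0 and x, and monotonicity of \<Phi> trades the
  factor at x for one at w. Both the uniform bound on the solution and the bound on its product with
  w follow from this.\<close>

lemma stein_solution_le_mills_ratio: "stein_solution x w \<le> mills_ratio \<bar>w\<bar>"
proof -
  note [simp] = std_normal_cdf_bounds mills_ratio_nonneg
  have pos: "0 < std_normal_density w" by (rule std_normal_density_pos)
  consider "w \<le> x" "w \<le> 0" | "w \<le> x" "0 < w" | "x < w" "0 \<le> w" | "x < w" "w < 0"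
    by linarith
  then show ?thesis
  proof cases
    case 1
    then show ?thesis
      using mult_right_mono[of "1 - std_normal_cdf x" 1 "mills_ratio (- w)"]
      by (simp add: stein_solution_def)
  next
    case 2
    have "(1 - std_normal_cdf x) * std_normal_cdf w \<le> (1 - std_normal_cdf w) * 1"
      using std_normal_cdf_mono[OF 2(1)] by (intro mult_mono) simp_all
    then show ?thesis
      using 2 pos by (simp add: stein_solution_def mills_ratio_uminus)
        (simp add: mills_ratio_def divide_right_mono)
  next
    case 3
    then show ?thesis
      using mult_right_mono[of "std_normal_cdf x" 1 "mills_ratio w"]
      by (simp add: stein_solution_def)
  next
    case 4
    have "std_normal_cdf x * (1 - std_normal_cdf w) \<le> std_normal_cdf w * 1"
      using std_normal_cdf_mono[of x w] 4 by (intro mult_mono) simp_all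
    then show ?thesis
      using 4 pos by (simp add: stein_solution_def mills_ratio_uminus)
        (simp add: mills_ratio_def divide_right_mono)
  qed
qed

lemma stein_solution_le: "stein_solution x w \<le> mills_ratio 0"
  using stein_solution_le_mills_ratio[of x w] mills_ratio_antimono[of 0 "\<bar>w\<bar>"] by linarith

lemma abs_mult_stein_solution_le_1: "\<bar>w * stein_solution x w\<bar> \<le> 1"
proof -
  have "\<bar>w\<bar> * stein_solution x w \<le> \<bar>w\<bar> * mills_ratio \<bar>w\<bar>"
    by (intro mult_left_mono stein_solution_le_mills_ratio) simp
  also have "\<dots> \<le> 1" by (rule mult_mills_ratio_le_1)
  finally show ?thesis
    by (simp add: abs_mult stein_solution_nonneg)
qed

text \<open>The two branches agree at \<open>w = x\<close>, so the right-hand formula is valid on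
  the closed half-line and the mean value theorem can be applied from x onwards.\<close>

lemma stein_solution_right: "x \<le> w \<Longrightarrow> stein_solution x w = std_normal_cdf x * mills_ratio w"
  by (auto simp: stein_solution_def mills_ratio_uminus) (simp add: mills_ratio_def)

text \<open>The solution has a corner at x, so the mean value theorem is applied to each smooth
  branch separately, with the derivative already rewritten by Stein's equation.\<close>

lemma stein_solution_mvt_left:
  assumes "u < v" "v \<le> x"
  shows "\<exists>z>u. z < v \<and> stein_solution x v - stein_solution x u =
           (v - u) * (z * stein_solution x z + 1 - std_normal_cdf x)"
proof -
  have "((\<lambda>w. (1 - std_normal_cdf x) * mills_ratio (- w)) has_real_derivative
      z * ((1 - std_normal_cdf x) * mills_ratio (- z)) + 1 - std_normal_cdf x) (at z)" for z
    by (rule derivative_eq_intros refl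
          DERIV_chain'[OF DERIV_minus[OF DERIV_ident] has_real_derivative_mills_ratio]
        | simp add: algebra_simps)+
  from MVT2[OF assms(1) this] show ?thesis
    using assms by (force simp: stein_solution_def)
qed

lemma stein_solution_mvt_right:
  assumes "u < v" "x \<le> u"
  shows "\<exists>z>u. z < v \<and> stein_solution x v - stein_solution x u =
           (v - u) * (z * stein_solution x z - std_normal_cdf x)"
proof -
  have "((\<lambda>w. std_normal_cdf x * mills_ratio w) has_real_derivative
      z * (std_normal_cdf x * mills_ratio z) - std_normal_cdf x) (at z)" for z
    by (rule derivative_eq_intros refl has_real_derivative_mills_ratio
        | simp add: algebra_simps)+
  from MVT2[OF assms(1) this] show ?thesis
    using assms by (force simp: stein_solution_right)
qed

text \<open>On either side of x the derivative is \<open>z * f z\<close> plus a constant, each of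
  modulus at most 1, which gives the 2. An interval containing x in its interior is cut
  there.\<close>

lemma stein_solution_lipschitz:
  assumes "u \<le> v"
  shows "\<bar>stein_solution x v - stein_solution x u\<bar> \<le> 2 * (v - u)"
proof -
  let ?f = "stein_solution x"
  have bnd: "\<bar>(v - u) * (z * ?f z + c)\<bar> \<le> 2 * (v - u)" if "u < v" "\<bar>c\<bar> \<le> 1" for u v z c
  proof -
    have "\<bar>z * ?f z + c\<bar> \<le> 2"
      using abs_mult_stein_solution_le_1[of z x] that by linarith
    then show ?thesis
      using that mult_left_mono[of "\<bar>z * ?f z + c\<bar>" 2 "v - u"] by (simp add: abs_mult mult.commute)
  qed
  have left: "\<bar>?f v - ?f u\<bar> \<le> 2 * (v - u)" if "u \<le> v" "v \<le> x" for u v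
  proof (cases "u = v")
    case False
    then obtain z where "?f v - ?f u = (v - u) * (z * ?f z + (1 - std_normal_cdf x))"
      using stein_solution_mvt_left[of u v x] \<open>u \<le> v\<close> \<open>v \<le> x\<close> by (auto simp: add_diff_eq)
    then show ?thesis
      using bnd[of u v "1 - std_normal_cdf x" z] False \<open>u \<le> v\<close> std_normal_cdf_bounds[of x] by simp
  qed simp
  have right: "\<bar>?f v - ?f u\<bar> \<le> 2 * (v - u)" if "u \<le> v" "x \<le> u" for u v
  proof (cases "u = v")
    case False
    then obtain z where "?f v - ?f u = (v - u) * (z * ?f z + (- std_normal_cdf x))"
      using stein_solution_mvt_right[of u v x] \<open>u \<le> v\<close> \<open>x \<le> u\<close> by auto
    then show ?thesis
      using bnd[of u v "- std_normal_cdf x" z] False \<open>u \<le> v\<close> std_normal_cdf_bounds[of x] by simp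
  qed simp
  consider "v \<le> x" | "x \<le> u" | "u < x" "x < v" by linarith
  then show ?thesis
  proof cases
    case 3
    then have "\<bar>?f x - ?f u\<bar> \<le> 2 * (x - u)" "\<bar>?f v - ?f x\<bar> \<le> 2 * (v - x)"
      using left[of u x] right[of x v] by auto
    from add_mono[OF this] show ?thesis
      using abs_triangle_ineq[of "?f x - ?f u" "?f v - ?f x"] by simp
  qed (use left right assms in auto)
qed

text \<open>If the corner lies in the step from w to w + d, increment and linear term are each at
  most 2 d in modulus. Otherwise the step stays in one branch and the derivative varies only through
  \<open>z * f z\<close>, which costs a second factor d.\<close>

lemma stein_solution_increment:
  assumes "0 < d"
  shows "\<bar>stein_solution x (w + d) - stein_solution x w
            - d * (w * stein_solution x w + of_bool (w \<le> x) - std_normal_cdf x)\<bar>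
         \<le> d\<^sup>2 * (mills_ratio 0 + 2 * \<bar>w\<bar>) + 4 * d * of_bool (w \<le> x \<and> x < w + d)"
    (is "\<bar>?R\<bar> \<le> _")
proof (cases "w \<le> x \<and> x < w + d")
  case True
  have "\<bar>w * stein_solution x w + 1 - std_normal_cdf x\<bar> \<le> 2"
    using abs_mult_stein_solution_le_1[of w x] std_normal_cdf_bounds[of x] by linarith
  then have "\<bar>d * (w * stein_solution x w + 1 - std_normal_cdf x)\<bar> \<le> 2 * d"
    using assms by (simp add: abs_mult mult.commute)
  moreover have "\<bar>stein_solution x (w + d) - stein_solution x w\<bar> \<le> 2 * d"
    using stein_solution_lipschitz[of w "w + d" x] assms by simp
  moreover have "0 \<le> d\<^sup>2 * (mills_ratio 0 + 2 * \<bar>w\<bar>)"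
    by (simp add: mills_ratio_nonneg)
  ultimately show ?thesis using True by simp
next
  case False
  have "\<exists>z>w. z < w + d \<and> stein_solution x (w + d) - stein_solution x w =
      d * (z * stein_solution x z + of_bool (w \<le> x) - std_normal_cdf x)"
    \<comment> \<open>Outside the straddling case \<open>w \<le> x\<close> forces
      \<open>w + d \<le> x\<close>, so the indicator at w already decides the branch.\<close>
    using stein_solution_mvt_left[of w "w + d" x] stein_solution_mvt_right[of w "w + d" x] assms False
    by (cases "w \<le> x") auto
  then obtain z where z: "w < z" "z < w + d"
    and eq: "stein_solution x (w + d) - stein_solution x w =
      d * (z * stein_solution x z + of_bool (w \<le> x) - std_normal_cdf x)" by blast
  have "?R = d * ((z - w) * stein_solution x z + w * (stein_solution x z - stein_solution x w))"
    unfolding eq by (simp add: algebra_simps)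
  also have "\<bar>\<dots>\<bar> \<le> d * (d * mills_ratio 0 + \<bar>w\<bar> * (2 * d))"
  proof -
    have "\<bar>(z - w) * stein_solution x z\<bar> \<le> d * mills_ratio 0"
      unfolding abs_mult using z
      by (intro mult_mono) (auto simp: stein_solution_nonneg stein_solution_le)
    moreover have "\<bar>w * (stein_solution x z - stein_solution x w)\<bar> \<le> \<bar>w\<bar> * (2 * d)"
      unfolding abs_mult using z stein_solution_lipschitz[of w z x]
      by (intro mult_left_mono) auto
    ultimately show ?thesis
      using assms abs_triangle_ineq[of "(z - w) * stein_solution x z"
        "w * (stein_solution x z - stein_solution x w)"]
      by (simp add: abs_mult[of d] del: abs_triangle_ineq)
  qed
  also have "\<dots> = d\<^sup>2 * (mills_ratio 0 + 2 * \<bar>w\<bar>)"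
    by (simp add: algebra_simps power2_eq_square)
  finally show ?thesis
    using False by (auto simp del: of_bool_eq_1_iff)
qed

section \<open>Normal approximation from a discrete Stein kernel\<close>

text \<open>The arithmetic-geometric mean inequality. It bounds first absolute moments by the
  variance pointwise, so no Cauchy-Schwarz inequality for sums has to be invoked.\<close>

lemma abs_le_mean_square:
  fixes y \<sigma> :: real
  assumes "0 < \<sigma>"
  shows "\<bar>y\<bar> \<le> (y\<^sup>2 + \<sigma>\<^sup>2) / (2 * \<sigma>)"
proof -
  have "0 \<le> (\<bar>y\<bar> - \<sigma>)\<^sup>2" by simp
  then have "\<bar>y\<bar> * (2 * \<sigma>) \<le> y\<^sup>2 + \<sigma>\<^sup>2"
    by (simp add: power2_diff algebra_simps)
  then show ?thesis
    using assms by (simp add: pos_le_divide_eq)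
qed

text \<open>The factor 2 on the kernel's deviation bounds the derivative of Stein's solution;
  \<open>B * (mills_ratio 0 + 2)\<close> collects the smooth Taylor remainder, and 4 the steps
  across the corner.\<close>

lemma stein_kernel_kolmogorov_bound:
  fixes p \<tau> :: "nat \<Rightarrow> real"
  assumes p_nonneg: "\<And>k. k \<in> A \<Longrightarrow> 0 \<le> p k"
    and p_sum: "(\<Sum>k\<in>A. p k) = 1"
    and var: "(\<Sum>k\<in>A. p k * (real k - \<mu>)\<^sup>2) = \<sigma>\<^sup>2"
    and \<sigma>: "0 < \<sigma>"
    and stein: "\<And>g :: nat \<Rightarrow> real. (\<Sum>k\<in>A. p k * ((real k - \<mu>) * g k)) =
                  (\<Sum>k\<in>A. p k * (\<tau> k * (g (Suc k) - g k)))"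
    and \<tau>_nonneg: "\<And>k. k \<in> A \<Longrightarrow> 0 \<le> \<tau> k"
    and \<tau>_le: "\<And>k. k \<in> A \<Longrightarrow> \<tau> k \<le> B * \<sigma>\<^sup>2"
  shows "\<bar>(\<Sum>k\<in>A. p k * of_bool ((real k - \<mu>) / \<sigma> \<le> x)) - std_normal_cdf x\<bar>
         \<le> 2 * (\<Sum>k\<in>A. p k * \<bar>1 - \<tau> k / \<sigma>\<^sup>2\<bar>) + (B * (mills_ratio 0 + 2) + 4) / \<sigma>"
proof -
  define w where "w k = (real k - \<mu>) / \<sigma>" for k
  define d where "d = 1 / \<sigma>"
  define f where "f = stein_solution x"
  \<comment> \<open>Defined through Stein's equation, so that it also has a value at the corner
    \<open>v = x\<close>, the left derivative.\<close>
  define f' where "f' v = v * f v + of_bool (v \<le> x) - std_normal_cdf x" for v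
  define s :: "nat \<Rightarrow> real" where "s k = of_bool (w k \<le> x \<and> x < w k + d)" for k
  have d: "0 < d" using \<sigma> by (simp add: d_def)
  have w_Suc: "w (Suc k) = w k + d" for k
    by (simp add: w_def d_def add_divide_distrib diff_divide_distrib)
  have abs_mean: "(\<Sum>k\<in>A. p k * \<bar>real k - \<mu>\<bar>) \<le> \<sigma>"
  proof -
    have "(\<Sum>k\<in>A. p k * \<bar>real k - \<mu>\<bar>) \<le> (\<Sum>k\<in>A. p k * (((real k - \<mu>)\<^sup>2 + \<sigma>\<^sup>2) / (2 * \<sigma>)))"
      by (intro sum_mono mult_left_mono p_nonneg abs_le_mean_square \<sigma>)
    also have "\<dots> = ((\<Sum>k\<in>A. p k * (real k - \<mu>)\<^sup>2) + \<sigma>\<^sup>2 * (\<Sum>k\<in>A. p k)) / (2 * \<sigma>)"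
      by (simp only: times_divide_eq_right sum_divide_distrib[symmetric] distrib_left sum.distrib
            sum_distrib_right[symmetric] mult.commute[of "sum p A"])
    also have "\<dots> = \<sigma>"
      unfolding var p_sum using \<sigma> by (simp add: power2_eq_square)
    finally show ?thesis .
  qed
  have straddle: "(\<Sum>k\<in>A. p k * (\<tau> k * s k)) \<le> \<sigma>"
  proof -
    \<comment> \<open>\<open>s\<close> is the forward difference of the step function
      \<open>of_bool (x < w k)\<close>; the kernel identity therefore turns this sum into a
      truncated first moment.\<close>
    have "(\<Sum>k\<in>A. p k * (\<tau> k * s k)) = (\<Sum>k\<in>A. p k * (\<tau> k * (of_bool (x < w (Suc k)) - of_bool (x < w k))))"
      using d by (intro sum.cong refl) (auto simp: s_def w_Suc)
    also have "\<dots> = (\<Sum>k\<in>A. p k * ((real k - \<mu>) * of_bool (x < w k)))"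
      by (rule stein[symmetric])
    also have "\<dots> \<le> (\<Sum>k\<in>A. p k * \<bar>real k - \<mu>\<bar>)"
      by (intro sum_mono mult_left_mono p_nonneg) auto
    finally show ?thesis using abs_mean by linarith
  qed
  let ?R = "\<lambda>k. f (w k + d) - f (w k) - d * f' (w k)"
  have wf: "(\<Sum>k\<in>A. p k * (w k * f (w k))) = (\<Sum>k\<in>A. p k * (\<tau> k / \<sigma> * (f (w k + d) - f (w k))))"
  proof -
    have "(\<Sum>k\<in>A. p k * (w k * f (w k))) = (\<Sum>k\<in>A. p k * ((real k - \<mu>) * f (w k))) / \<sigma>"
      by (simp add: sum_divide_distrib w_def)
    also have "\<dots> = (\<Sum>k\<in>A. p k * (\<tau> k * (f (w (Suc k)) - f (w k)))) / \<sigma>"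
      by (simp only: stein[of "\<lambda>k. f (w k)"])
    finally show ?thesis
      by (simp add: sum_divide_distrib w_Suc)
  qed
  \<comment> \<open>Adds and subtracts the linear Taylor term, using
    \<open>d / \<sigma> = 1 / \<sigma>\<^sup>2\<close>. Here b stands for the derivative, c for the
    increment and t for the kernel.\<close>
  have regroup: "a * b - a * (t / \<sigma> * c) = a * (b * (1 - t / \<sigma>\<^sup>2) - t / \<sigma> * (c - d * b))" for a b c t
    using \<sigma> by (simp add: d_def field_simps power2_eq_square)
  have linear: "(\<Sum>k\<in>A. p k * (2 * X k + (b * (m + 2 * Y k) + c * Z k)))
      = 2 * (\<Sum>k\<in>A. p k * X k) + b * (m * (\<Sum>k\<in>A. p k) + 2 * (\<Sum>k\<in>A. p k * Y k))
        + c * (\<Sum>k\<in>A. p k * Z k)" for X Y Z b m c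
  proof -
    have "p k * (2 * X k + (b * (m + 2 * Y k) + c * Z k))
        = 2 * (p k * X k) + b * (m * p k + 2 * (p k * Y k)) + c * (p k * Z k)" for k
      by (simp add: algebra_simps)
    then show ?thesis
      by (simp only: sum.distrib sum_distrib_left[symmetric])
  qed
  have "(\<Sum>k\<in>A. p k * of_bool (w k \<le> x)) - std_normal_cdf x
      = (\<Sum>k\<in>A. p k * of_bool (w k \<le> x)) - (\<Sum>k\<in>A. p k) * std_normal_cdf x"
    using p_sum by simp
  also have "\<dots> = (\<Sum>k\<in>A. p k * f' (w k)) - (\<Sum>k\<in>A. p k * (w k * f (w k)))"
    unfolding sum_distrib_right sum_subtractf[symmetric]
    by (intro sum.cong refl) (simp add: f'_def algebra_simps)
  also have "\<dots> = (\<Sum>k\<in>A. p k * (f' (w k) * (1 - \<tau> k / \<sigma>\<^sup>2) - \<tau> k / \<sigma> * ?R k))"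
    unfolding wf sum_subtractf[symmetric] by (intro sum.cong refl regroup)
  finally have decomp: "(\<Sum>k\<in>A. p k * of_bool (w k \<le> x)) - std_normal_cdf x
      = (\<Sum>k\<in>A. p k * (f' (w k) * (1 - \<tau> k / \<sigma>\<^sup>2) - \<tau> k / \<sigma> * ?R k))" .
  have "\<bar>(\<Sum>k\<in>A. p k * of_bool (w k \<le> x)) - std_normal_cdf x\<bar> \<le> (\<Sum>k\<in>A. p k * (2 * \<bar>1 - \<tau> k / \<sigma>\<^sup>2\<bar>
      + (B / \<sigma> * (mills_ratio 0 + 2 * \<bar>w k\<bar>) + 4 / \<sigma>\<^sup>2 * (\<tau> k * s k))))"
    unfolding decomp
  proof (rule order.trans[OF sum_abs sum_mono])
    fix k assume k: "k \<in> A"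
    have "\<bar>f' (w k)\<bar> \<le> 2"
      using abs_mult_stein_solution_le_1[of "w k" x] std_normal_cdf_bounds[of x]
      by (auto simp: f'_def f_def of_bool_def)
    then have 1: "\<bar>f' (w k) * (1 - \<tau> k / \<sigma>\<^sup>2)\<bar> \<le> 2 * \<bar>1 - \<tau> k / \<sigma>\<^sup>2\<bar>"
      unfolding abs_mult by (intro mult_right_mono) auto
    have "\<bar>?R k\<bar> \<le> d\<^sup>2 * (mills_ratio 0 + 2 * \<bar>w k\<bar>) + 4 * d * s k"
      unfolding f_def f'_def s_def by (rule stein_solution_increment[OF d])
    then have "\<bar>\<tau> k / \<sigma> * ?R k\<bar> \<le> \<tau> k / \<sigma> * (d\<^sup>2 * (mills_ratio 0 + 2 * \<bar>w k\<bar>) + 4 * d * s k)"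
      using \<tau>_nonneg[OF k] \<sigma> by (simp add: abs_mult mult_left_mono divide_right_mono)
    also have "\<dots> = \<tau> k * (d\<^sup>2 / \<sigma>) * (mills_ratio 0 + 2 * \<bar>w k\<bar>) + 4 / \<sigma>\<^sup>2 * (\<tau> k * s k)"
      using \<sigma> by (simp add: d_def field_simps power2_eq_square)
    \<comment> \<open>The bound on the kernel is spent on the smooth remainder only; the corner term
      keeps \<open>\<tau> k\<close>, as \<open>straddle\<close> requires.\<close>
    also have "\<tau> k * (d\<^sup>2 / \<sigma>) * (mills_ratio 0 + 2 * \<bar>w k\<bar>)
        \<le> B * \<sigma>\<^sup>2 * (d\<^sup>2 / \<sigma>) * (mills_ratio 0 + 2 * \<bar>w k\<bar>)"
      using \<tau>_le[OF k] \<sigma> mills_ratio_nonneg[of 0] by (intro mult_right_mono) auto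
    also have "B * \<sigma>\<^sup>2 * (d\<^sup>2 / \<sigma>) = B / \<sigma>"
      using \<sigma> by (simp add: d_def power2_eq_square)
    finally have 2: "\<bar>\<tau> k / \<sigma> * ?R k\<bar>
        \<le> B / \<sigma> * (mills_ratio 0 + 2 * \<bar>w k\<bar>) + 4 / \<sigma>\<^sup>2 * (\<tau> k * s k)" by simp
    have "\<bar>f' (w k) * (1 - \<tau> k / \<sigma>\<^sup>2) - \<tau> k / \<sigma> * ?R k\<bar>
        \<le> 2 * \<bar>1 - \<tau> k / \<sigma>\<^sup>2\<bar> + (B / \<sigma> * (mills_ratio 0 + 2 * \<bar>w k\<bar>) + 4 / \<sigma>\<^sup>2 * (\<tau> k * s k))"
      by (rule order.trans[OF abs_triangle_ineq4 add_mono[OF 1 2]])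
    then show "\<bar>p k * (f' (w k) * (1 - \<tau> k / \<sigma>\<^sup>2) - \<tau> k / \<sigma> * ?R k)\<bar>
      \<le> p k * (2 * \<bar>1 - \<tau> k / \<sigma>\<^sup>2\<bar>
          + (B / \<sigma> * (mills_ratio 0 + 2 * \<bar>w k\<bar>) + 4 / \<sigma>\<^sup>2 * (\<tau> k * s k)))"
      unfolding abs_mult[of "p k"] abs_of_nonneg[OF p_nonneg[OF k]]
      by (rule mult_left_mono[OF _ p_nonneg[OF k]])
  qed
  also have "\<dots> = 2 * (\<Sum>k\<in>A. p k * \<bar>1 - \<tau> k / \<sigma>\<^sup>2\<bar>) + B / \<sigma> * (mills_ratio 0 * (\<Sum>k\<in>A. p k)
      + 2 * ((\<Sum>k\<in>A. p k * \<bar>real k - \<mu>\<bar>) / \<sigma>)) + 4 / \<sigma>\<^sup>2 * (\<Sum>k\<in>A. p k * (\<tau> k * s k))"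
  proof -
    have mean_w: "(\<Sum>k\<in>A. p k * \<bar>real k - \<mu>\<bar>) / \<sigma> = (\<Sum>k\<in>A. p k * \<bar>w k\<bar>)"
      using \<sigma> by (simp add: sum_divide_distrib w_def)
    show ?thesis
      unfolding mean_w by (rule linear)
  qed
  also have "\<dots> \<le> 2 * (\<Sum>k\<in>A. p k * \<bar>1 - \<tau> k / \<sigma>\<^sup>2\<bar>) + B / \<sigma> * (mills_ratio 0 * 1 + 2 * 1) + 4 / \<sigma>\<^sup>2 * \<sigma>"
  proof -
    \<comment> \<open>Total mass 1 supplies an index, at which \<open>0 \<le> \<tau> k\<close> and
      \<open>\<tau> k \<le> B * \<sigma>\<^sup>2\<close> give \<open>0 \<le> B\<close>.\<close>
    have "A \<noteq> {}" using p_sum by auto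
    then obtain k where k: "k \<in> A" by blast
    have "0 \<le> B * \<sigma>\<^sup>2"
      by (rule order.trans[OF \<tau>_nonneg[OF k] \<tau>_le[OF k]])
    then have B: "0 \<le> B" using \<sigma> by (simp add: zero_le_mult_iff)
    have "(\<Sum>k\<in>A. p k * \<bar>real k - \<mu>\<bar>) / \<sigma> \<le> 1"
      using \<sigma> abs_mean by (simp only: divide_le_eq_1_pos)
    then have 1: "B / \<sigma> * (mills_ratio 0 * (\<Sum>k\<in>A. p k) + 2 * ((\<Sum>k\<in>A. p k * \<bar>real k - \<mu>\<bar>) / \<sigma>))
        \<le> B / \<sigma> * (mills_ratio 0 * 1 + 2 * 1)"
      unfolding p_sum using \<sigma> B by (intro mult_left_mono add_left_mono) simp_all
    have 2: "4 / \<sigma>\<^sup>2 * (\<Sum>k\<in>A. p k * (\<tau> k * s k)) \<le> 4 / \<sigma>\<^sup>2 * \<sigma>"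
      by (rule mult_left_mono[OF straddle]) simp
    show ?thesis
      by (rule add_mono[OF add_left_mono[OF 1] 2])
  qed
  also have "\<dots> = 2 * (\<Sum>k\<in>A. p k * \<bar>1 - \<tau> k / \<sigma>\<^sup>2\<bar>) + (B * (mills_ratio 0 + 2) + 4) / \<sigma>"
    using \<sigma> by (simp add: power2_eq_square field_simps)
  finally show ?thesis
    by (simp add: w_def)
qed

section \<open>The Stein kernel of the Narayana distribution\<close>

lemma binomial_Suc_real:
  "real (Suc k) * real (n choose Suc k) = (real n - real k) * real (n choose k)"
proof (cases "k \<le> n")
  case True
  have "Suc k * (n choose Suc k) = (n - k) * (n choose k)"
    using binomial_absorb_comp[of n k] binomial_absorption[of k n] by simp
  then have "real (Suc k * (n choose Suc k)) = real ((n - k) * (n choose k))" by simp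
  then show ?thesis using True by (simp only: of_nat_mult of_nat_diff)
qed (simp add: binomial_eq_0)

text \<open>Each of the two binomial factors moves up by one index. Writing k = \<open>Suc j\<close>
  keeps the \<open>k - 1\<close> in \<open>narayana\<close> from truncating, and clearing
  denominators keeps the recursion valid where the numbers vanish.\<close>

lemma narayana_Suc_Suc:
  "real (Suc j) * real (Suc (Suc j)) * narayana n (Suc (Suc j)) =
   (real n - real j) * (real n - real (Suc j)) * narayana n (Suc j)"
proof -
  have "real (Suc j) * real (Suc (Suc j)) * narayana n (Suc (Suc j)) =
      1 / real n * (real (Suc j) * real (n choose Suc j)) * (real (Suc (Suc j)) * real (n choose Suc (Suc j)))"
    by (simp add: narayana_def)
  also have "\<dots> = 1 / real n * ((real n - real j) * real (n choose j))
      * ((real n - real (Suc j)) * real (n choose Suc j))"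
    by (simp only: binomial_Suc_real)
  finally show ?thesis by (simp add: narayana_def ac_simps)
qed

text \<open>This is the birth rate of a birth-death chain reversible for the Narayana weights. The
  death rate is k (k - 1) / (2 n), and the divisor 2 n makes death minus birth equal to k -
  \<mu>.\<close>

definition narayana_stein_kernel :: "nat \<Rightarrow> nat \<Rightarrow> real" where
  "narayana_stein_kernel n k = (real n - real k) * (real n - real k + 1) / (2 * real n)"

text \<open>Summation by parts: detailed balance, which is the ratio recursion, moves the kernel at
  k to the death rate \<rho> at k + 1.\<close>

lemma narayana_stein_identity:
  assumes "n \<ge> 1"
  shows "(\<Sum>k=1..n. narayana n k * ((real k - narayana_mean n) * g k)) =
         (\<Sum>k=1..n. narayana n k * (narayana_stein_kernel n k * (g (Suc k) - g k)))"
proof -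
  define \<rho> where "\<rho> k = real k * (real k - 1) / (2 * real n)" for k
  define h where "h j = narayana n (Suc j) * \<rho> (Suc j) * g (Suc j)" for j
  have \<rho>: "real k - narayana_mean n = \<rho> k - narayana_stein_kernel n k" for k
    using assms by (simp add: \<rho>_def narayana_stein_kernel_def narayana_mean_def field_simps)
  have shift: "narayana n (Suc j) * narayana_stein_kernel n (Suc j) * g (Suc (Suc j)) = h (Suc j)" for j
  proof -
    have "narayana n (Suc j) * narayana_stein_kernel n (Suc j)
        = ((real n - real j) * (real n - real (Suc j)) * narayana n (Suc j)) / (2 * real n)"
      by (simp add: narayana_stein_kernel_def)
    also have "\<dots> = narayana n (Suc (Suc j)) * \<rho> (Suc (Suc j))"
      by (simp only: narayana_Suc_Suc[symmetric]) (simp add: \<rho>_def)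
    finally show ?thesis by (simp add: h_def)
  qed
  have "(\<Sum>k=1..n. narayana n k * narayana_stein_kernel n k * g (Suc k)) = (\<Sum>j<n. h (Suc j))"
    by (simp add: sum.atLeast1_atMost_eq shift)
  also have "\<dots> = (\<Sum>j<n. h j)"
  proof -
    have "(\<Sum>j<n. h (Suc j)) = (\<Sum>j<n. h (Suc j) - h j) + (\<Sum>j<n. h j)"
      by (simp add: sum_subtractf)
    also have "(\<Sum>j<n. h (Suc j) - h j) = h n - h 0"
      by (rule sum_lessThan_telescope)
    \<comment> \<open>No boundary terms: \<rho> vanishes at 1, and \<open>narayana n (Suc n)\<close>
      is 0 because \<open>n choose Suc n\<close> is.\<close>
    also have "h n - h 0 = 0"
      by (simp add: h_def \<rho>_def narayana_def)
    finally show ?thesis by simp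
  qed
  also have "\<dots> = (\<Sum>k=1..n. narayana n k * \<rho> k * g k)"
    by (simp add: sum.atLeast1_atMost_eq h_def)
  finally show ?thesis
    unfolding \<rho> by (simp add: algebra_simps sum_subtractf)
qed

text \<open>Expansion of the kernel in powers of k - \<mu>; its constant term (n - 1) (n + 1) / (8
  n) equals \<open>(narayana_sd n)\<^sup>2 * (1 - 1 / (2 * real n))\<close>. This form yields both
  the variance and the concentration of the kernel.\<close>

lemma narayana_stein_kernel_centered:
  assumes "n \<ge> 2"
  shows "narayana_stein_kernel n k - (narayana_sd n)\<^sup>2 =
    ((real k - narayana_mean n)\<^sup>2 - (narayana_sd n)\<^sup>2) / (2 * real n) - (real k - narayana_mean n) / 2"
proof -
  have sd: "(narayana_sd n)\<^sup>2 = (real n - 1) * (real n + 1) / (4 * (2 * real n - 1))"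
    using assms by (simp add: narayana_sd_def)
  have "(narayana_sd n)\<^sup>2 * (1 - 1 / (2 * real n)) = (real n - 1) * (real n + 1) / (8 * real n)"
    unfolding sd using assms by (simp add: divide_simps)
  moreover have "narayana_stein_kernel n k = (real n - 1) * (real n + 1) / (8 * real n)
      - (real k - narayana_mean n) / 2 + (real k - narayana_mean n)\<^sup>2 / (2 * real n)"
    using assms by (simp add: narayana_stein_kernel_def narayana_mean_def field_simps power2_eq_square)
  ultimately show ?thesis
    by (simp add: algebra_simps diff_divide_distrib)
qed

text \<open>Clearing denominators reduces the inequality to \<open>2 \<le> n\<close>, with equality
  at n = 2.\<close>

lemma narayana_sd_ge:
  assumes "n \<ge> 2"
  shows "real n / 8 \<le> (narayana_sd n)\<^sup>2"
proof -
  have "(narayana_sd n)\<^sup>2 = (real n - 1) * (real n + 1) / (4 * (2 * real n - 1))"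
    using assms by (simp add: narayana_sd_def)
  moreover have "real n / 8 \<le> (real n - 1) * (real n + 1) / (4 * (2 * real n - 1))"
    using assms by (simp add: field_simps)
  ultimately show ?thesis by simp
qed

section \<open>The rate of convergence for Narayana numbers\<close>

lemma narayana_kolmogorov_bound:
  assumes n: "n \<ge> 2"
  shows "\<bar>\<P>(K in measure_pmf (narayana_pmf n). narayana_std n K \<le> x) - std_normal_cdf x\<bar>
         \<le> (12 * mills_ratio 0 + 41) / sqrt (real n)"
proof -
  define p where "p k = narayana n k / catalan n" for k
  let ?\<mu> = "narayana_mean n" and ?\<sigma> = "narayana_sd n" and ?\<tau> = "narayana_stein_kernel n"
  have n1: "n \<ge> 1" using n by simp
  have \<sigma>: "0 < ?\<sigma>" using n by (rule narayana_sd_pos)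
  have catalan: "0 < catalan n" by (simp add: catalan_def)
  have p_nonneg: "0 \<le> p k" for k
    using catalan by (simp add: p_def narayana_def)
  have p_sum: "(\<Sum>k=1..n. p k) = 1"
    using catalan sum_narayana[OF n1] by (simp add: p_def sum_divide_distrib[symmetric])
  have stein: "(\<Sum>k=1..n. p k * ((real k - ?\<mu>) * g k)) = (\<Sum>k=1..n. p k * (?\<tau> k * (g (Suc k) - g k)))" for g
    using narayana_stein_identity[OF n1, of g]
    by (simp add: p_def sum_divide_distrib[symmetric])
  have mean: "(\<Sum>k=1..n. p k * (real k - ?\<mu>)) = 0"
    using stein[of "\<lambda>_. 1"] by simp
  have \<tau>: "?\<tau> k = ?\<sigma>\<^sup>2 + ((real k - ?\<mu>)\<^sup>2 - ?\<sigma>\<^sup>2) / (2 * real n) - (real k - ?\<mu>) / 2" for k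
    using narayana_stein_kernel_centered[OF n, of k] by simp
  \<comment> \<open>The test function k - \<mu> shows that the variance is the mean of the kernel.
    The kernel is quadratic in k - \<mu> and the mean deviation is 0, so this is a linear equation
    for the variance with leading factor 1 - 1/(2 n), which is nonzero.\<close>
  have var: "(\<Sum>k=1..n. p k * (real k - ?\<mu>)\<^sup>2) = ?\<sigma>\<^sup>2" (is "?V = _")
  proof -
    have "?V = (\<Sum>k=1..n. p k * ?\<tau> k)"
      using stein[of "\<lambda>k. real k - ?\<mu>"] by (simp add: power2_eq_square)
    also have "\<dots> = (\<Sum>k=1..n. p k) * (?\<sigma>\<^sup>2 - ?\<sigma>\<^sup>2 / (2 * real n)) + ?V / (2 * real n)
        - (\<Sum>k=1..n. p k * (real k - ?\<mu>)) / 2"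
      unfolding \<tau>
      by (simp add: sum_distrib_right sum_divide_distrib sum.distrib[symmetric] sum_subtractf[symmetric]
            algebra_simps diff_divide_distrib add_divide_distrib)
    also have "\<dots> = ?\<sigma>\<^sup>2 - ?\<sigma>\<^sup>2 / (2 * real n) + ?V / (2 * real n)"
      by (simp only: p_sum mean) simp
    finally have "(?V - ?\<sigma>\<^sup>2) * (1 - 1 / (2 * real n)) = 0"
      by (simp add: algebra_simps)
    then show ?thesis using n by auto
  qed
  have \<tau>_nonneg: "0 \<le> ?\<tau> k" if "k \<in> {1..n}" for k
    using that by (simp add: narayana_stein_kernel_def)
  have \<tau>_le: "?\<tau> k \<le> 4 * ?\<sigma>\<^sup>2" if "k \<in> {1..n}" for k
  proof -
    have "(real n - real k) * (real n - real k + 1) \<le> real n * real n"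
      using that by (intro mult_mono) auto
    then have "?\<tau> k \<le> real n / 2"
      using n by (simp add: narayana_stein_kernel_def field_simps)
    also have "\<dots> \<le> 4 * ?\<sigma>\<^sup>2" using narayana_sd_ge[OF n] by simp
    finally show ?thesis .
  qed
  \<comment> \<open>Both the linear and the quadratic part of the kernel's deviation are dominated
    by multiples of \<open>?D\<^sup>2 + ?\<sigma>\<^sup>2\<close>, whose expectation is
    \<open>2 * ?\<sigma>\<^sup>2\<close>.\<close>
  have dev: "(\<Sum>k=1..n. p k * \<bar>1 - ?\<tau> k / ?\<sigma>\<^sup>2\<bar>) \<le> 1 / (2 * ?\<sigma>) + 1 / real n"
  proof -
    have "(\<Sum>k=1..n. p k * \<bar>1 - ?\<tau> k / ?\<sigma>\<^sup>2\<bar>)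
        \<le> (\<Sum>k=1..n. p k * (((real k - ?\<mu>)\<^sup>2 + ?\<sigma>\<^sup>2) * (1 / (2 * real n * ?\<sigma>\<^sup>2) + 1 / (4 * ?\<sigma> ^ 3))))"
    proof (intro sum_mono mult_left_mono p_nonneg)
      fix k
      let ?D = "real k - ?\<mu>"
      have "1 - ?\<tau> k / ?\<sigma>\<^sup>2 = (?D / 2 - (?D\<^sup>2 - ?\<sigma>\<^sup>2) / (2 * real n)) / ?\<sigma>\<^sup>2"
        unfolding \<tau> using \<sigma> by (simp add: field_simps)
      also have "\<bar>\<dots>\<bar> \<le> ((?D\<^sup>2 + ?\<sigma>\<^sup>2) / (4 * ?\<sigma>) + (?D\<^sup>2 + ?\<sigma>\<^sup>2) / (2 * real n)) / ?\<sigma>\<^sup>2"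
      proof -
        have "\<bar>?D / 2\<bar> \<le> (?D\<^sup>2 + ?\<sigma>\<^sup>2) / (4 * ?\<sigma>)"
          using \<sigma> abs_le_mean_square[OF \<sigma>, of ?D] by (simp add: field_simps)
        moreover have "\<bar>(?D\<^sup>2 - ?\<sigma>\<^sup>2) / (2 * real n)\<bar> \<le> (?D\<^sup>2 + ?\<sigma>\<^sup>2) / (2 * real n)"
          unfolding abs_divide by (simp add: abs_le_iff divide_right_mono)
        ultimately have "\<bar>?D / 2 - (?D\<^sup>2 - ?\<sigma>\<^sup>2) / (2 * real n)\<bar>
            \<le> (?D\<^sup>2 + ?\<sigma>\<^sup>2) / (4 * ?\<sigma>) + (?D\<^sup>2 + ?\<sigma>\<^sup>2) / (2 * real n)"
          by linarith
        then show ?thesis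
          by (simp only: abs_divide[of _ "?\<sigma>\<^sup>2"] abs_power2) (intro divide_right_mono; simp)
      qed
      also have "\<dots> = (?D\<^sup>2 + ?\<sigma>\<^sup>2) * (1 / (2 * real n * ?\<sigma>\<^sup>2) + 1 / (4 * ?\<sigma> ^ 3))"
        using \<sigma> n by (simp add: field_simps power2_eq_square power3_eq_cube)
      finally show "\<bar>1 - ?\<tau> k / ?\<sigma>\<^sup>2\<bar> \<le> (?D\<^sup>2 + ?\<sigma>\<^sup>2) * (1 / (2 * real n * ?\<sigma>\<^sup>2) + 1 / (4 * ?\<sigma> ^ 3))" .
    qed
    also have "\<dots> = (?V + ?\<sigma>\<^sup>2 * (\<Sum>k=1..n. p k)) * (1 / (2 * real n * ?\<sigma>\<^sup>2) + 1 / (4 * ?\<sigma> ^ 3))"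
      by (simp only: sum_distrib_left sum_distrib_right sum.distrib[symmetric] mult.assoc[symmetric] distrib_left mult.commute)
    also have "\<dots> = 1 / (2 * ?\<sigma>) + 1 / real n"
      unfolding var p_sum using \<sigma> n by (simp add: field_simps power2_eq_square power3_eq_cube)
    finally show ?thesis .
  qed
  have prob: "\<P>(K in measure_pmf (narayana_pmf n). narayana_std n K \<le> x)
      = (\<Sum>k=1..n. p k * of_bool ((real k - ?\<mu>) / ?\<sigma> \<le> x))"
  proof -
    have "\<P>(K in measure_pmf (narayana_pmf n). narayana_std n K \<le> x)
        = measure_pmf.expectation (narayana_pmf n) (indicator {K. narayana_std n K \<le> x})"
      by simp
    also have "\<dots> = (\<Sum>k=1..n. pmf (narayana_pmf n) k *\<^sub>R indicator {K. narayana_std n K \<le> x} k)"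
      by (rule integral_measure_pmf)
         (auto simp: set_pmf_eq pmf_narayana_pmf[OF n1] split: if_splits)
    also have "\<dots> = (\<Sum>k=1..n. p k * of_bool ((real k - ?\<mu>) / ?\<sigma> \<le> x))"
      by (intro sum.cong refl)
         (auto simp: pmf_narayana_pmf[OF n1] p_def narayana_std_def indicator_def)
    finally show ?thesis .
  qed
  \<comment> \<open>\<open>narayana_sd_ge\<close> gives n \<le> 8 \<open>?\<sigma>\<^sup>2\<close>;
    8 is rounded up to the square 9.\<close>
  have inv_\<sigma>: "1 / ?\<sigma> \<le> 3 / sqrt (real n)"
  proof -
    have "sqrt (real n) \<le> sqrt ((3 * ?\<sigma>)\<^sup>2)"
      using narayana_sd_ge[OF n] by (intro real_sqrt_le_mono) (simp add: power_mult_distrib)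
    also have "\<dots> = 3 * ?\<sigma>" using \<sigma> by (intro real_sqrt_unique) auto
    finally show ?thesis using \<sigma> n by (simp add: field_simps)
  qed
  have inv_n: "1 / real n \<le> 1 / sqrt (real n)"
    using n by (intro divide_left_mono real_le_lsqrt) (auto simp: self_le_power)
  have "\<bar>\<P>(K in measure_pmf (narayana_pmf n). narayana_std n K \<le> x) - std_normal_cdf x\<bar>
      \<le> 2 * (\<Sum>k=1..n. p k * \<bar>1 - ?\<tau> k / ?\<sigma>\<^sup>2\<bar>) + (4 * (mills_ratio 0 + 2) + 4) / ?\<sigma>"
    unfolding prob by (rule stein_kernel_kolmogorov_bound[OF p_nonneg p_sum var \<sigma> stein \<tau>_nonneg \<tau>_le])
  also have "\<dots> \<le> 2 * (1 / (2 * ?\<sigma>) + 1 / real n) + (4 * (mills_ratio 0 + 2) + 4) / ?\<sigma>"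
    using dev by simp
  also have "\<dots> = (4 * mills_ratio 0 + 13) * (1 / ?\<sigma>) + 2 * (1 / real n)"
    using \<sigma> by (simp add: field_simps)
  \<comment> \<open>The 13 is 1 from \<open>dev\<close> plus 4 * 2 + 4 from the kernel bound with B
    = 4; then 3 * 13 + 2 = 41.\<close>
  also have "\<dots> \<le> (4 * mills_ratio 0 + 13) * (3 / sqrt (real n)) + 2 * (1 / sqrt (real n))"
    using inv_\<sigma> inv_n mills_ratio_nonneg[of 0] by (intro add_mono mult_left_mono) auto
  also have "\<dots> = (12 * mills_ratio 0 + 41) / sqrt (real n)"
    using n by (simp add: field_simps)
  finally show ?thesis .
qed

theorem corollary1p2:
  shows "\<exists>C::real. \<forall>n::nat. n \<ge> 2 \<longrightarrow>
    (SUP x::real. \<bar>\<P>(K in measure_pmf (narayana_pmf n). narayana_std n K \<le> x)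
        - std_normal_cdf x\<bar>) \<le> C / sqrt (real n)"
  \<comment> \<open>The pointwise bound is uniform in x, so it passes to the supremum. Here
    \<open>mills_ratio 0\<close> is the square root of \<pi>/2.\<close>
  by (intro exI[of _ "12 * mills_ratio 0 + 41"] allI impI cSUP_least narayana_kolmogorov_bound) auto

end
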